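(* Let $n$ be the number of states of the (minimized) target system $\mathcal{M}$. The base algorithm terminates after at most $n-1$ equivalence queries that return a counterexample (i.e. at most $n-1$ equivalence queries, not counting the final one that confirms equivalence).
   Context: **Mealy machines.** A Mealy machine is $\mathcal{M}=\langle S,s_0,I,O,\delta,\lambda\rangle$ with non-empty state set $S$, initial state $s_0$, finite alphabets $I,O$, $\delta:S\times I\to S$, $\lambda:S\times I\to O$. Both are extended to words: $\delta(s,aw)=\delta(\delta(s,a),w)$, $\lambda(s,aw)=\lambda(s,a)\lambda(\delta(s,a),w)$, $\delta(s,\varepsilon)=s$, $\lambda(s,\varepsilon)=\varepsilon$; write $\delta(w)=\delta(s_0,w)$, $\lambda(w)=\lambda(s_0,w)$. The unknown target system $\mathcal{M}$ is finite, deterministic, complete and minimal (no machine with fewer states produces the same output word for every input word). **Queries.** A reset query puts $\mathcal{M}$ into its initial state; a symbol query executes one input symbol on $\mathcal{M}$ and returns the output symbol. A membership query $mq(w)=\lambda_{\mathcal{M}}(w)$ is a reset query followed by the symbol queries of $w$; $mq(u,v)$ is the last $|v|$ symbols of $mq(uv)$. An equivalence query for a hypothesis $\mathcal{H}$ either confirms equivalence or returns a counterexample $\langle w,\lambda_{\mathcal{M}}(w)\rangle$ with $\lambda_{\mathcal{H}}(w)\ne\lambda_{\mathcal{M}}(w)$. **Adaptive discrimination tree (ADT) $\mathcal{T}$.** A rooted tree of symbol nodes (each with an input symbol; edges to children carry pairwise distinct output symbols), reset nodes (exactly one child, unlabelled edge) and final nodes (exactly the leaves, each referencing a hypothesis state).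 It is a single final node or its root is a symbol node. For a node $x$, cut the root-to-$x$ path at its reset nodes; each segment of symbol nodes yields a pair $\langle i,o\rangle$ of the input word of its symbol nodes and the output word of the edges leaving them along the path. $traces(x)$ is the set of these pairs. **Sift$(w)$** (called with $\mathcal{M}$ in state $\delta_{\mathcal{M}}(w)$): start at the root; at a symbol node pose its symbol query and follow the edge labelled with the output (if there is none, create it, leading to a new final node without reference); at a reset node pose a reset query, then the symbols of $w$, and go to the child; at a final node return it. **Base algorithm.** It maintains a hypothesis $\mathcal{H}$, an access sequence $acc(s)\in I^*$ for each state $s$ of $\mathcal{H}$, an ADT $\mathcal{T}$, a queue $Open$ of transitions $\langle s,i\rangle$ and a queue $CE$ of counterexamples. - *CloseTransitions*: while $Open\neq\emptyset$, pop $\langle s,i\rangle$; pose a reset query, the symbols of $acc(s)$, then $i$, and set $\lambda_{\mathcal{H}}(s,i)$ to the last output; let $f=$ Sift$(acc(s)\cdot i)$. If $f$ has no reference, add a new state $r$ to $\mathcal{H}$ with $acc(r)=acc(s)\cdot i$, let $f$ reference $r$, set $\delta_{\mathcal{H}}(s,i)=r$ and add all $\langle r,j\rangle$, $j\in I$, to $Open$; otherwise let $\delta_{\mathcal{H}}(s,i)$ be the state referenced by $f$. - *Initialization*: $\mathcal{H}$ has the single state $s_0$ with $acc(s_0)=\varepsilon$, $\mathcal{T}$ is a single final node referencing $s_0$; put all $\langle s_0,i\rangle$ in $Open$ and run CloseTransitions. - *Internal refinement* for $\langle in,out\rangle$ with $\lambda_{\mathcal{H}}(in)\ne out$: decompose,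 by binary search on $in$, the word as $in=uav$ with $u\in I^*$, $a\in I$, $v\in I^+$ and $mq(acc(\delta_{\mathcal{H}}(u))\cdot a,v)\neq mq(acc(\delta_{\mathcal{H}}(ua)),v)$. Let $q=\delta_{\mathcal{H}}(ua)$. Add a new state $r$ with $acc(r)=acc(\delta_{\mathcal{H}}(u))\cdot a$ and set $\delta_{\mathcal{H}}(\delta_{\mathcal{H}}(u),a)=r$. Replace the final node of $q$ in $\mathcal{T}$ by a reset node (omitted if the final node is the root) followed by the chain of symbol nodes spelling $v$, with edges labelled by the outputs $mq(acc(q),v)$ and $mq(acc(r),v)$, branching at their first difference into two final nodes referencing $q$ and $r$. Put all $\langle r,i\rangle$ ($i\in I$) and all $\langle s,i\rangle$ with $\delta_{\mathcal{H}}(s,i)=q$ in $Open$; run CloseTransitions. - *Refinement* with counterexample $c$: add $c$ to $CE$; while $CE\ne\emptyset$: (1) while $CE\neq\emptyset$, pop a counterexample $\langle in,out\rangle$ and perform internal refinements as long as $\lambda_{\mathcal{H}}(in)\ne out$; (2) for each final node $f$ of $\mathcal{T}$ referencing $s_f$ and each $\langle i,o\rangle\in traces(f)$, if $\mathcal{H}$ does not output $o$ when $i$ is applied after $acc(s_f)$, add the corresponding counterexample to $CE$. - *Main loop*: run Initialization; repeatedly pose an equivalence query for $\mathcal{H}$, performing a refinement with each returned counterexample; stop and return $\mathcal{H}$ when equivalence is confirmed. *)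

theory Defs
  imports Main
begin

section \<open>Mealy machines\<close>

record ('s, 'i, 'o) mealy =
  states :: "'s set"
  init_state :: 's
  inputs :: "'i set"
  outputs :: "'o set"
  next_state :: "'s \<Rightarrow> 'i \<Rightarrow> 's"
  out_sym :: "'s \<Rightarrow> 'i \<Rightarrow> 'o"

definition is_mealy :: "('s, 'i, 'o) mealy \<Rightarrow> bool" where
  "is_mealy M \<longleftrightarrow>
     init_state M \<in> states M \<and> finite (inputs M) \<and> finite (outputs M) \<and>
     (\<forall>s \<in> states M. \<forall>i \<in> inputs M. next_state M s i \<in> states M \<and> out_sym M s i \<in> outputs M)"

primrec delta :: "('s, 'i, 'o) mealy \<Rightarrow> 's \<Rightarrow> 'i list \<Rightarrow> 's" where
  "delta M s [] = s"
| "delta M s (a # w) = delta M (next_state M s a) w"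

primrec lambda :: "('s, 'i, 'o) mealy \<Rightarrow> 's \<Rightarrow> 'i list \<Rightarrow> 'o list" where
  "lambda M s [] = []"
| "lambda M s (a # w) = out_sym M s a # lambda M (next_state M s a) w"

abbreviation delta0 :: "('s, 'i, 'o) mealy \<Rightarrow> 'i list \<Rightarrow> 's" where
  "delta0 M w \<equiv> delta M (init_state M) w"

abbreviation lambda0 :: "('s, 'i, 'o) mealy \<Rightarrow> 'i list \<Rightarrow> 'o list" where
  "lambda0 M w \<equiv> lambda M (init_state M) w"

definition equivalent :: "('s, 'i, 'o) mealy \<Rightarrow> ('t, 'i, 'o) mealy \<Rightarrow> bool" where
  "equivalent M N \<longleftrightarrow> (\<forall>w \<in> lists (inputs M). lambda0 M w = lambda0 N w)"

text \<open>The competitors \<open>N\<close> range over machines with states in the same type. This is no restriction: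
  a machine with fewer states than the finite machine \<open>M\<close> is isomorphic to one whose states form a
  subset of \<open>states M\<close>.\<close>

definition minimal :: "('s, 'i, 'o) mealy \<Rightarrow> bool" where
  "minimal M \<longleftrightarrow>
     \<not> (\<exists>N :: ('s, 'i, 'o) mealy. is_mealy N \<and> inputs N = inputs M \<and> outputs N = outputs M \<and>
          finite (states N) \<and> card (states N) < card (states M) \<and> equivalent M N)"

text \<open>\<open>mq M u v\<close>: the last \<open>length v\<close> symbols of the membership query for \<open>u @ v\<close>.\<close>

definition mq :: "('s, 'i, 'o) mealy \<Rightarrow> 'i list \<Rightarrow> 'i list \<Rightarrow> 'o list" where
  "mq M u v = drop (length u) (lambda0 M (u @ v))"


section \<open>Adaptive discrimination trees\<close>

text \<open>Hypothesis states are natural numbers. The children of a symbol node form a partial map, so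
  its edges carry pairwise distinct outputs. \<open>Final None\<close> is a final node without reference.\<close>

datatype ('i, 'o) adt =
    Final "nat option"
  | Reset "('i, 'o) adt"
  | Sym 'i "'o \<Rightarrow> ('i, 'o) adt option"

text \<open>A node is identified by the path leading to it from the root: \<open>Some (i, b)\<close> is the step from
  a symbol node for \<open>i\<close> along its edge labelled \<open>b\<close>, and \<open>None\<close> is the step below a reset node.\<close>

type_synonym ('i, 'o) path = "('i \<times> 'o) option list"

inductive node_at :: "('i, 'o) adt \<Rightarrow> ('i, 'o) path \<Rightarrow> ('i, 'o) adt \<Rightarrow> bool" where
  here: "node_at t [] t"
| below_reset: "node_at t p x \<Longrightarrow> node_at (Reset t) (None # p) x"
| below_symbol: "ch b = Some t \<Longrightarrow> node_at t p x \<Longrightarrow> node_at (Sym i ch) (Some (i, b) # p) x"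

text \<open>Only meant for paths that exist in the tree.\<close>

fun replace_at :: "('i, 'o) path \<Rightarrow> ('i, 'o) adt \<Rightarrow> ('i, 'o) adt \<Rightarrow> ('i, 'o) adt" where
  "replace_at [] x t = x"
| "replace_at (None # p) x (Reset t) = Reset (replace_at p x t)"
| "replace_at (Some (_, b) # p) x (Sym i ch) = Sym i (ch(b := map_option (replace_at p x) (ch b)))"

text \<open>The maximal segments of a path between reset nodes, first segment first.\<close>

primrec segments :: "('i, 'o) path \<Rightarrow> ('i \<times> 'o) list list" where
  "segments [] = [[]]"
| "segments (e # p) =
     (case e of
        None \<Rightarrow> [] # segments p
      | Some io \<Rightarrow> (io # hd (segments p)) # tl (segments p))"

definition traces :: "('i, 'o) path \<Rightarrow> ('i list \<times> 'o list) set" where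
  "traces p = (\<lambda>seg. (map fst seg, map snd seg)) ` set (segments p)"

text \<open>\<open>sift M w t s\<close> sifts \<open>w\<close> through \<open>t\<close> while \<open>M\<close> is in state \<open>s\<close>. It returns the tree, possibly
  extended by a new final node without reference, and the path of the final node reached.\<close>

primrec sift ::
  "('s, 'i, 'o) mealy \<Rightarrow> 'i list \<Rightarrow> ('i, 'o) adt \<Rightarrow> 's \<Rightarrow> ('i, 'o) adt \<times> ('i, 'o) path" where
  "sift M w (Final r) = (\<lambda>s. (Final r, []))"
| "sift M w (Reset t) = (\<lambda>s. case sift M w t (delta0 M w) of (t', p) \<Rightarrow> (Reset t', None # p))"
| "sift M w (Sym i ch) = (\<lambda>s.
     let b = out_sym M s i in
     case map_option (sift M w) (ch b) of
       None \<Rightarrow> (Sym i (ch(b \<mapsto> Final None)), [Some (i, b)])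
     | Some f \<Rightarrow> (case f (next_state M s i) of
         (t', p) \<Rightarrow> (Sym i (ch(b \<mapsto> t')), Some (i, b) # p)))"

text \<open>The chain of symbol nodes spelling \<open>v\<close> that separates the states \<open>q\<close> and \<open>r\<close>, given their
  (distinct) output words on \<open>v\<close>. It ends in the two final nodes at the first difference of the
  outputs. Only meant for words of equal length with distinct outputs.\<close>

fun chain :: "'i list \<Rightarrow> 'o list \<Rightarrow> 'o list \<Rightarrow> nat \<Rightarrow> nat \<Rightarrow> ('i, 'o) adt" where
  "chain (a # v) (x # xs) (y # ys) q r =
     Sym a (if x = y then [x \<mapsto> chain v xs ys q r]
            else [x \<mapsto> Final (Some q), y \<mapsto> Final (Some r)])"


section \<open>The base algorithm\<close>

text \<open>Control points outside CloseTransitions: about to pose an equivalence query; at the outer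
  loop of a refinement; at its inner loop; performing internal refinements for one popped
  counterexample; returned. CloseTransitions runs whenever \<open>open_queue\<close> is non-empty, and takes
  precedence over all other steps.\<close>

datatype ('i, 'o) phase =
    Query | Outer | Inner | Internal "'i list" "'o list" | Returned

text \<open>The transition and output functions of the hypothesis are undefined (\<open>None\<close>) on a transition
  that has not been closed yet. \<open>acc\<close> is only meaningful on \<open>hyp_states\<close>. \<open>ce_queries\<close> counts the
  equivalence queries that have returned a counterexample.\<close>

record ('i, 'o) config =
  hyp_states :: "nat set"
  hyp_next :: "nat \<times> 'i \<Rightarrow> nat option"
  hyp_out :: "nat \<times> 'i \<Rightarrow> 'o option"
  acc :: "nat \<Rightarrow> 'i list"
  tree :: "('i, 'o) adt"
  open_queue :: "(nat \<times> 'i) list"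
  ce_queue :: "('i list \<times> 'o list) list"
  phase :: "('i, 'o) phase"
  ce_queries :: nat

definition hypothesis :: "('s, 'i, 'o) mealy \<Rightarrow> ('i, 'o) config \<Rightarrow> (nat, 'i, 'o) mealy" where
  "hypothesis M c =
     \<lparr>states = hyp_states c, init_state = 0, inputs = inputs M, outputs = outputs M,
      next_state = (\<lambda>s i. the (hyp_next c (s, i))),
      out_sym = (\<lambda>s i. the (hyp_out c (s, i)))\<rparr>"

text \<open>The order in which a set of items is put into a queue is left open.\<close>

definition enumerates :: "'a list \<Rightarrow> 'a set \<Rightarrow> bool" where
  "enumerates xs A \<longleftrightarrow> distinct xs \<and> set xs = A"

definition initial :: "('s, 'i, 'o) mealy \<Rightarrow> ('i, 'o) config \<Rightarrow> bool" where
  "initial M c \<longleftrightarrow>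
     (\<exists>js. enumerates js ({0} \<times> inputs M) \<and>
       c = \<lparr>hyp_states = {0}, hyp_next = Map.empty, hyp_out = Map.empty, acc = (\<lambda>_. []),
            tree = Final (Some 0), open_queue = js, ce_queue = [], phase = Query,
            ce_queries = 0\<rparr>)"

text \<open>The traces that contradict the hypothesis: final node (as a path), state referenced by it,
  input word and output word of the trace.\<close>

definition violated ::
  "('s, 'i, 'o) mealy \<Rightarrow> ('i, 'o) config \<Rightarrow> (('i, 'o) path \<times> nat \<times> 'i list \<times> 'o list) set" where
  "violated M c =
     {(p, q, x, y). node_at (tree c) p (Final (Some q)) \<and> (x, y) \<in> traces p \<and>
        lambda (hypothesis M c) (delta0 (hypothesis M c) (acc c q)) x \<noteq> y}"

inductive step :: "('s, 'i, 'o) mealy \<Rightarrow> ('i, 'o) config \<Rightarrow> ('i, 'o) config \<Rightarrow> bool"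
  for M :: "('s, 'i, 'o) mealy" and c :: "('i, 'o) config" where
  close_known:
    "step M c
       (c\<lparr>hyp_out := (hyp_out c)((s, i) \<mapsto> last (lambda0 M w)),
          hyp_next := (hyp_next c)((s, i) \<mapsto> q),
          tree := t, open_queue := rest\<rparr>)"
    if "open_queue c = (s, i) # rest"
      and "w = acc c s @ [i]"
      and "sift M w (tree c) (delta0 M w) = (t, p)"
      and "node_at t p (Final (Some q))"
| close_new:
    "step M c
       (c\<lparr>hyp_states := insert r (hyp_states c),
          hyp_out := (hyp_out c)((s, i) \<mapsto> last (lambda0 M w)),
          hyp_next := (hyp_next c)((s, i) \<mapsto> r),
          acc := (acc c)(r := w),
          tree := replace_at p (Final (Some r)) t,
          open_queue := rest @ js\<rparr>)"
    if "open_queue c = (s, i) # rest"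
      and "w = acc c s @ [i]"
      and "sift M w (tree c) (delta0 M w) = (t, p)"
      and "node_at t p (Final None)"
      and "r \<notin> hyp_states c"
      and "enumerates js ({r} \<times> inputs M)"
| confirm:
    "step M c (c\<lparr>phase := Returned\<rparr>)"
    if "open_queue c = []" and "phase c = Query"
      and "equivalent M (hypothesis M c)"
| counterexample:
    "step M c
       (c\<lparr>ce_queue := ce_queue c @ [(w, lambda0 M w)], phase := Outer,
          ce_queries := Suc (ce_queries c)\<rparr>)"
    if "open_queue c = []" and "phase c = Query"
      and "w \<in> lists (inputs M)"
      and "lambda0 (hypothesis M c) w \<noteq> lambda0 M w"
| outer_enter:
    "step M c (c\<lparr>phase := Inner\<rparr>)"
    if "open_queue c = []" and "phase c = Outer" and "ce_queue c \<noteq> []"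
| outer_exit:
    "step M c (c\<lparr>phase := Query\<rparr>)"
    if "open_queue c = []" and "phase c = Outer" and "ce_queue c = []"
| inner_pop:
    "step M c (c\<lparr>ce_queue := rest, phase := Internal x y\<rparr>)"
    if "open_queue c = []" and "phase c = Inner" and "ce_queue c = (x, y) # rest"
| internal_refine:
    "step M c
       (c\<lparr>hyp_states := insert r (hyp_states c),
          hyp_next := next',
          acc := (acc c)(r := acc c s @ [a]),
          tree := replace_at p (if p = [] then sep else Reset sep) (tree c),
          open_queue := js\<rparr>)"
    if "open_queue c = []" and "phase c = Internal x y"
      and "lambda0 (hypothesis M c) x \<noteq> y"
      and "x = u @ [a] @ v" and "v \<noteq> []"
      and "s = delta0 (hypothesis M c) u"
      and "q = delta0 (hypothesis M c) (u @ [a])"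
      and "mq M (acc c s @ [a]) v \<noteq> mq M (acc c q) v"
      and "r \<notin> hyp_states c"
      and "next' = (hyp_next c)((s, a) \<mapsto> r)"
      and "node_at (tree c) p (Final (Some q))"
      and "sep = chain v (mq M (acc c q) v) (mq M (acc c s @ [a]) v) q r"
      and "enumerates js ({r} \<times> inputs M \<union> {e. next' e = Some q})"
| internal_done:
    "step M c (c\<lparr>phase := Inner\<rparr>)"
    if "open_queue c = []" and "phase c = Internal x y"
      and "lambda0 (hypothesis M c) x = y"
| check_traces:
    "step M c
       (c\<lparr>ce_queue := map (\<lambda>(p, q, x, y). (acc c q @ x, lambda0 M (acc c q) @ y)) vs,
          phase := Outer\<rparr>)"
    if "open_queue c = []" and "phase c = Inner" and "ce_queue c = []"
      and "enumerates vs (violated M c)"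

definition reachable :: "('s, 'i, 'o) mealy \<Rightarrow> ('i, 'o) config \<Rightarrow> bool" where
  "reachable M c \<longleftrightarrow> (\<exists>c0. initial M c0 \<and> (step M)\<^sup>*\<^sup>* c0 c)"

text \<open>Every run terminates, whatever the order of the queues, the decompositions chosen by internal
  refinements and the counterexamples returned: there is no infinite run, and a run stops only by
  returning the hypothesis after a confirmed equivalence query.\<close>

definition terminates :: "('s, 'i, 'o) mealy \<Rightarrow> bool" where
  "terminates M \<longleftrightarrow>
     \<not> (\<exists>run :: nat \<Rightarrow> ('i, 'o) config. initial M (run 0) \<and> (\<forall>k. step M (run k) (run (Suc k)))) \<and>
     (\<forall>c. reachable M c \<and> \<not> (\<exists>c'. step M c c') \<longrightarrow> phase c = Returned)"

end

theory Submission
  imports Defs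
begin

text \<open>The access sequence of every hypothesis state sifts to the final node referencing that state.
  Sifting is determined by the state of \<open>M\<close> reached by the sifted word, so access sequences of
  distinct hypothesis states reach distinct states of \<open>M\<close>, and there are at most \<open>n\<close> hypothesis
  states. A counterexample for the current hypothesis admits a decomposition, and it stays in the
  queues until an internal refinement adds a state; hence every equivalence query answered by a
  counterexample is followed by a new state before the next query. Termination follows
  lexicographically from the number of states, the number of queries, the length of the open queue,
  whether a counterexample for the current hypothesis is still waiting, and the length of the
  counterexample queue.\<close>

section \<open>Output words and paths\<close>

lemma delta_append: "delta M s (u @ v) = delta M (delta M s u) v"
  by (induction u arbitrary: s) auto

lemma lambda_append: "lambda M s (u @ v) = lambda M s u @ lambda M (delta M s u) v"
  by (induction u arbitrary: s) auto

lemma length_lambda [simp]: "length (lambda M s u) = length u"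
  by (induction u arbitrary: s) auto

lemma mq_eq: "mq M u v = lambda M (delta0 M u) v"
  by (simp add: mq_def lambda_append)

lemma delta_in_states:
  assumes "is_mealy M" and "s \<in> states M" and "w \<in> lists (inputs M)"
  shows "delta M s w \<in> states M"
  using assms(2,3) by (induction w arbitrary: s) (use assms(1) in \<open>auto simp: is_mealy_def\<close>)

text \<open>\<open>consistent M m s p\<close>: the path \<open>p\<close> agrees with the outputs of \<open>M\<close> when it is entered in state
  \<open>s\<close> and every reset node brings \<open>M\<close> to state \<open>m\<close>.\<close>

fun consistent :: "('s, 'i, 'o) mealy \<Rightarrow> 's \<Rightarrow> 's \<Rightarrow> ('i, 'o) path \<Rightarrow> bool" where
  "consistent M m s [] \<longleftrightarrow> True"
| "consistent M m s (None # p) \<longleftrightarrow> consistent M m m p"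
| "consistent M m s (Some (i, b) # p) \<longleftrightarrow> out_sym M s i = b \<and> consistent M m (next_state M s i) p"

lemma consistent_append_reset:
  "consistent M m s (p @ None # p') \<longleftrightarrow> consistent M m s p \<and> consistent M m m p'"
  by (induction M m s p rule: consistent.induct) auto

section \<open>Nodes of a tree and replacement of a final node\<close>

lemma node_at_simps [simp]:
  "node_at t [] x \<longleftrightarrow> x = t"
  "node_at (Final f) p x \<longleftrightarrow> p = [] \<and> x = Final f"
  "node_at (Reset t) (None # p) x \<longleftrightarrow> node_at t p x"
  "\<not> node_at (Reset t) (Some e # p) x"
  "\<not> node_at (Sym i ch) (None # p) x"
  "node_at (Sym i ch) (Some (j, b) # p) x \<longleftrightarrow> j = i \<and> (\<exists>t. ch b = Some t \<and> node_at t p x)"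
  by (auto elim: node_at.cases intro: node_at.intros)

lemma node_at_Reset: "node_at (Reset t) p x \<longleftrightarrow> (p = [] \<and> x = Reset t) \<or> (\<exists>p'. p = None # p' \<and> node_at t p' x)"
  by (auto elim: node_at.cases intro: node_at.intros)

lemma node_at_Sym:
  "node_at (Sym i ch) p x \<longleftrightarrow>
     (p = [] \<and> x = Sym i ch) \<or> (\<exists>b t p'. p = Some (i, b) # p' \<and> ch b = Some t \<and> node_at t p' x)"
  by (auto elim: node_at.cases intro: node_at.intros)

lemma node_at_unique: "node_at t p x \<Longrightarrow> node_at t p y \<Longrightarrow> x = y"
  by (induction rule: node_at.induct) auto

text \<open>The outputs of \<open>M\<close> determine the edge taken at every symbol node, so two
  consistent paths cannot part at a branching, and neither can stop before the other because both
  end in final nodes.\<close>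

lemma consistent_leaf_unique:
  assumes "node_at t p x" and "x = Final f" and "node_at t p' (Final f')"
    and "consistent M m s p" and "consistent M m s p'"
  shows "p = p'"
  using assms
proof (induction arbitrary: s p' rule: node_at.induct)
  case (here t)
  then show ?case by simp
next
  case (below_reset t p x)
  then show ?case by (auto simp: node_at_Reset)
next
  case (below_symbol ch b t p x i)
  from below_symbol.prems(2) obtain b' t' p'' where
    "p' = Some (i, b') # p''" "ch b' = Some t'" "node_at t' p'' (Final f')"
    by (auto simp: node_at_Sym)
  with below_symbol show ?case by auto
qed

text \<open>The node at \<open>p\<close> is a leaf, so no other final node lies below it: the
  replacement loses that leaf alone and gains exactly those of \<open>x\<close>.\<close>

lemma node_at_replace_at:
  assumes "node_at t p y" and "y = Final f"
  shows "node_at (replace_at p x t) p' (Final k) \<longleftrightarrow>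
    (node_at t p' (Final k) \<and> p' \<noteq> p) \<or> (\<exists>p''. p' = p @ p'' \<and> node_at x p'' (Final k))"
  using assms
proof (induction arbitrary: p' rule: node_at.induct)
  case (here t)
  then show ?case by auto
next
  case (below_reset t p y)
  then show ?case by (cases p') (auto simp: node_at_Reset)
next
  case (below_symbol ch b t p y i)
  show ?case
  proof (cases "\<exists>p1. p' = Some (i, b) # p1")
    case True
    then show ?thesis using below_symbol by auto
  next
    case False
    then show ?thesis by (auto simp: node_at_Sym)
  qed
qed

lemma path_inputs: "node_at t p x \<Longrightarrow> Some (i, b) \<in> set p \<Longrightarrow> i \<in> set_adt t"
proof (induction rule: node_at.induct)
  case (below_symbol ch b' t p x j)
  have "set_adt t \<subseteq> set_adt (Sym j ch)"
    using below_symbol.hyps(1) by (fastforce simp: image_iff)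
  with below_symbol show ?case by auto
qed auto

lemma set_adt_replace_at:
  "node_at t p y \<Longrightarrow> set_adt (replace_at p x t) \<subseteq> set_adt t \<union> set_adt x"
proof (induction rule: node_at.induct)
  case (below_symbol ch b t p y i)
  then show ?case
    by (auto split: if_splits)
qed auto

section \<open>Segments and traces of a path\<close>

lemma hd_segments_in: "hd (segments p) \<in> set (segments p)"
  by (induction p) (auto split: option.splits)

lemma segments_neq_Nil [simp]: "segments p \<noteq> []"
  by (cases p) (auto split: option.splits)

text \<open>The first segment is entered in the current state \<open>s\<close>, every later one
  directly after a reset, that is in \<open>m\<close>; hence the split into head and tail.\<close>

lemma segments_outputs:
  "consistent M m s p \<Longrightarrow>
     lambda M s (map fst (hd (segments p))) = map snd (hd (segments p)) \<and>
     (\<forall>g \<in> set (tl (segments p)). lambda M m (map fst g) = map snd g)"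
proof (induction M m s p rule: consistent.induct)
  case (2 M m s p)
  then show ?case by (cases "segments p") auto
qed auto

lemma traces_outputs:
  assumes "consistent M m m p" and "(x, y) \<in> traces p"
  shows "y = lambda M m x"
proof -
  obtain g where g: "g \<in> set (segments p)" "x = map fst g" "y = map snd g"
    using assms(2) by (auto simp: traces_def)
  have "g = hd (segments p) \<or> g \<in> set (tl (segments p))"
    using g(1) by (cases "segments p") auto
  then show ?thesis using segments_outputs[OF assms(1)] g by auto
qed

lemma segments_subset: "g \<in> set (segments p) \<Longrightarrow> e \<in> set g \<Longrightarrow> Some e \<in> set p"
proof (induction p arbitrary: g)
  case (Cons o' p)
  then show ?case
    using hd_segments_in[of p] list.set_sel(2)[OF segments_neq_Nil]
    by (fastforce split: option.splits)
qed auto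

lemma traces_inputs: "node_at t p z \<Longrightarrow> (x, y) \<in> traces p \<Longrightarrow> set x \<subseteq> set_adt t"
  by (force simp: traces_def dest: segments_subset path_inputs)

lemma finite_traces: "finite (traces p)"
  by (simp add: traces_def)

section \<open>Sifting and separating chains\<close>

text \<open>Sifting follows the outputs of \<open>M\<close>, which makes its path consistent. The
  tree can only gain a final node without reference, so the leaves that reference states are
  unaffected.\<close>

lemma sift_correct:
  "sift M w t s = (t', p) \<Longrightarrow>
     consistent M (delta0 M w) s p \<and> (\<exists>f. node_at t' p (Final f)) \<and>
     (\<forall>p' q. node_at t' p' (Final (Some q)) \<longleftrightarrow> node_at t p' (Final (Some q))) \<and>
     set_adt t' \<subseteq> set_adt t"
proof (induction t arbitrary: s t' p)
  case (Final f)
  then show ?case by auto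
next
  case (Reset t)
  then show ?case by (fastforce simp: node_at_Reset split: prod.splits)
next
  case (Sym i ch)
  let ?b = "out_sym M s i"
  show ?case
  proof (cases "ch ?b")
    case None
    with Sym.prems have "t' = Sym i (ch(?b \<mapsto> Final None))" "p = [Some (i, ?b)]"
      by (auto simp: Let_def)
    moreover have "b \<noteq> ?b" if "ch b = Some t" for b t
      using None that by auto
    ultimately show ?thesis using None by (auto simp: node_at_Sym)
  next
    case (Some t)
    obtain t1 p1 where s1: "sift M w t (next_state M s i) = (t1, p1)" by fastforce
    with Some Sym.prems have eq: "t' = Sym i (ch(?b \<mapsto> t1))" "p = Some (i, ?b) # p1"
      by (auto simp: Let_def)
    \<comment> \<open>The induction hypothesis concerns the subtrees occurring in
      \<open>range ch\<close>.\<close>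
    have "Some t \<in> range ch"
      using Some by (metis rangeI)
    from Sym.IH[OF this _ s1] have IH: "consistent M (delta0 M w) (next_state M s i) p1"
        "\<exists>f. node_at t1 p1 (Final f)"
        "\<And>p' q. node_at t1 p' (Final (Some q)) \<longleftrightarrow> node_at t p' (Final (Some q))"
        "set_adt t1 \<subseteq> set_adt t"
      by auto
    have "set_adt t \<subseteq> set_adt (Sym i ch)"
      using \<open>Some t \<in> range ch\<close> by force
    then have "set_adt t' \<subseteq> set_adt (Sym i ch)"
      using IH(4) eq(1) by (auto split: if_splits)
    moreover have "node_at t' p' (Final (Some q)) \<longleftrightarrow> node_at (Sym i ch) p' (Final (Some q))" for p' q
      using IH(3) Some eq(1)
      by (cases "\<exists>p1. p' = Some (i, ?b) # p1") (auto, auto simp: node_at_Sym)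
    ultimately show ?thesis using IH(1,2) eq by auto
  qed
qed

lemma set_adt_chain:
  "length xs = length v \<Longrightarrow> length ys = length v \<Longrightarrow> xs \<noteq> ys \<Longrightarrow> set_adt (chain v xs ys q r) \<subseteq> set v"
proof (induction v xs ys q r rule: chain.induct)
  case (1 a v x xs y ys q r)
  then show ?case by (auto split: if_splits)
qed auto

text \<open>The leaves sit where the outputs of \<open>s\<close> and \<open>s'\<close> first differ.
  The reset states \<open>m\<close> and \<open>m'\<close> are arbitrary, since a chain contains no
  reset node.\<close>

lemma chain_leaves:
  assumes "lambda M s v \<noteq> lambda M s' v"
  shows "\<exists>pq pr. (\<forall>p k. node_at (chain v (lambda M s v) (lambda M s' v) q r) p (Final k) \<longleftrightarrow>
            (p = pq \<and> k = Some q) \<or> (p = pr \<and> k = Some r)) \<and>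
          consistent M m s pq \<and> consistent M m' s' pr"
  using assms
proof (induction v arbitrary: s s')
  case (Cons a v)
  show ?case
  proof (cases "out_sym M s a = out_sym M s' a")
    case True
    with Cons.prems have "lambda M (next_state M s a) v \<noteq> lambda M (next_state M s' a) v"
      by simp
    from Cons.IH[OF this] obtain pq pr where IH:
      "\<And>p k. node_at (chain v (lambda M (next_state M s a) v) (lambda M (next_state M s' a) v) q r)
          p (Final k) \<longleftrightarrow> (p = pq \<and> k = Some q) \<or> (p = pr \<and> k = Some r)"
      "consistent M m (next_state M s a) pq" "consistent M m' (next_state M s' a) pr"
      by blast
    show ?thesis
      by (rule exI[of _ "Some (a, out_sym M s a) # pq"], rule exI[of _ "Some (a, out_sym M s a) # pr"])
        (use True IH in \<open>auto simp: node_at_Sym\<close>)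
  next
    case False
    show ?thesis
      by (rule exI[of _ "[Some (a, out_sym M s a)]"], rule exI[of _ "[Some (a, out_sym M s' a)]"])
        (use False in \<open>auto simp: node_at_Sym split: if_splits\<close>)
  qed
qed auto

section \<open>Invariants of the base algorithm\<close>

abbreviation leaf :: "('i, 'o) adt \<Rightarrow> ('i, 'o) path \<Rightarrow> nat \<Rightarrow> bool" where
  "leaf t p q \<equiv> node_at t p (Final (Some q))"

abbreviation target :: "('s, 'i, 'o) mealy \<Rightarrow> ('i, 'o) config \<Rightarrow> nat \<Rightarrow> 's" where
  "target M c q \<equiv> delta0 M (acc c q)"

text \<open>Correctness relative to the tree: the state of \<open>M\<close> behind the transition
  must sift to the final node of \<open>q\<close>, but it may differ from
  \<open>target M c q\<close>. This gap is what a refinement exploits.\<close>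

definition closed :: "('s, 'i, 'o) mealy \<Rightarrow> ('i, 'o) config \<Rightarrow> nat \<Rightarrow> 'i \<Rightarrow> bool" where
  "closed M c s i \<longleftrightarrow> (\<exists>q p. hyp_next c (s, i) = Some q \<and>
     hyp_out c (s, i) = Some (out_sym M (target M c s) i) \<and> leaf (tree c) p q \<and>
     consistent M (next_state M (target M c s) i) (next_state M (target M c s) i) p)"

text \<open>By \<open>leaf_consistent\<close> each access sequence sifts to its own final node. Open
  transitions may carry outdated values, so correctness is demanded of the others only;
  \<open>dom_next\<close> keeps the set of transitions reopened by a refinement finite.\<close>

locale sound =
  fixes M :: "('s, 'i, 'o) mealy" and c :: "('i, 'o) config"
  assumes mealy: "is_mealy M"
    and finite_hyp: "finite (hyp_states c)"
    and zero_hyp: "0 \<in> hyp_states c"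
    and acc_zero: "acc c 0 = []"
    and acc_inputs: "q \<in> hyp_states c \<Longrightarrow> acc c q \<in> lists (inputs M)"
    and tree_inputs: "set_adt (tree c) \<subseteq> inputs M"
    and leaf_exists: "q \<in> hyp_states c \<Longrightarrow> \<exists>p. leaf (tree c) p q"
    and leaf_hyp: "leaf (tree c) p q \<Longrightarrow> q \<in> hyp_states c"
    and leaf_consistent: "leaf (tree c) p q \<Longrightarrow> consistent M (target M c q) (target M c q) p"
    and dom_next: "dom (hyp_next c) \<subseteq> hyp_states c \<times> inputs M"
    and open_hyp: "set (open_queue c) \<subseteq> hyp_states c \<times> inputs M"
    and not_open_closed: "s \<in> hyp_states c \<Longrightarrow> i \<in> inputs M \<Longrightarrow> (s, i) \<notin> set (open_queue c) \<Longrightarrow>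
      closed M c s i"
begin

abbreviation "H \<equiv> hypothesis M c"

lemma target_in_states: "q \<in> hyp_states c \<Longrightarrow> target M c q \<in> states M"
  using delta_in_states[OF mealy _ acc_inputs] mealy by (auto simp: is_mealy_def)

lemma leaf_unique:
  assumes "leaf (tree c) p q" and "leaf (tree c) p' q'"
    and "consistent M (target M c q) (target M c q) p'"
  shows "p' = p" and "q' = q"
proof -
  show "p' = p"
    using consistent_leaf_unique[OF assms(1) refl assms(2) leaf_consistent[OF assms(1)] assms(3)] ..
  then show "q' = q" using node_at_unique assms by blast
qed

text \<open>Two states with the same target would sift to the same final node, which references a
  single state.\<close>

lemma inj_target: "inj_on (target M c) (hyp_states c)"
proof (rule inj_onI)
  fix q q' assume "q \<in> hyp_states c" "q' \<in> hyp_states c" and eq: "target M c q = target M c q'"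
  then obtain p p' where "leaf (tree c) p q" "leaf (tree c) p' q'" using leaf_exists by blast
  then show "q = q'" using leaf_unique(2) leaf_consistent eq by metis
qed

lemma card_hyp: "finite (states M) \<Longrightarrow> card (hyp_states c) \<le> card (states M)"
  using card_inj_on_le[OF inj_target] target_in_states by blast

lemma finite_violated: "finite (violated M c)"
proof -
  define P where "P = (\<lambda>q. {p. leaf (tree c) p q})"
  \<comment> \<open>All paths to leaves of \<open>q\<close> are consistent with its target, hence
    equal.\<close>
  have "\<exists>p. P q \<subseteq> {p}" for q
    unfolding P_def using leaf_unique(1) leaf_consistent by blast
  then have "finite (P q)" for q by (metis finite.emptyI finite_insert finite_subset)
  moreover have "violated M c \<subseteq> (\<Union>q \<in> hyp_states c. \<Union>p \<in> P q. (\<lambda>(x, y). (p, q, x, y)) ` traces p)"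
    unfolding violated_def P_def using leaf_hyp by fastforce
  ultimately show ?thesis
    using finite_hyp finite_traces by (meson finite_UN_I finite_imageI finite_subset)
qed

text \<open>The edges on the path to the leaf of \<open>q\<close> carry the outputs of
  \<open>M\<close> after \<open>acc c q\<close>, so a violated trace refutes the hypothesis and not
  the tree.\<close>

lemma violated_counterexample:
  assumes "(p, q, x, y) \<in> violated M c"
  shows "acc c q @ x \<in> lists (inputs M)"
    and "lambda0 M (acc c q) @ y = lambda0 M (acc c q @ x)"
    and "lambda0 H (acc c q @ x) \<noteq> lambda0 M (acc c q) @ y"
proof -
  have leaf: "leaf (tree c) p q" and tr: "(x, y) \<in> traces p"
    and neq: "lambda H (delta0 H (acc c q)) x \<noteq> y"
    using assms by (auto simp: violated_def)
  show "acc c q @ x \<in> lists (inputs M)"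
    using acc_inputs[OF leaf_hyp[OF leaf]] traces_inputs[OF leaf tr] tree_inputs by auto
  show "lambda0 M (acc c q) @ y = lambda0 M (acc c q @ x)"
    using traces_outputs[OF leaf_consistent[OF leaf] tr] by (simp add: lambda_append)
  show "lambda0 H (acc c q @ x) \<noteq> lambda0 M (acc c q) @ y"
    using neq by (simp add: lambda_append)
qed

end

section \<open>The hypothesis when all transitions are closed\<close>

locale sound_closed = sound +
  assumes open_empty: "open_queue c = []"
begin

lemma closed_hypothesis:
  assumes "s \<in> hyp_states c" and "i \<in> inputs M"
  obtains q p where "hyp_next c (s, i) = Some q" and "next_state H s i = q"
    and "hyp_out c (s, i) = Some (out_sym M (target M c s) i)"
    and "out_sym H s i = out_sym M (target M c s) i"
    and "q \<in> hyp_states c" and "leaf (tree c) p q"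
    and "consistent M (delta0 M (acc c s @ [i])) (delta0 M (acc c s @ [i])) p"
  using not_open_closed[OF assms] open_empty leaf_hyp
  by (auto simp: closed_def hypothesis_def delta_append)

lemma delta_hyp:
  "s \<in> hyp_states c \<Longrightarrow> u \<in> lists (inputs M) \<Longrightarrow> delta H s u \<in> hyp_states c"
proof (induction u arbitrary: s)
  case (Cons a u)
  then show ?case using closed_hypothesis[of s a] by auto
qed simp

lemma init_H: "init_state H = 0"
  by (simp add: hypothesis_def)

text \<open>The words \<open>\<lambda>\<^sub>H(u) @ mq (acc (\<delta>\<^sub>H(u))) v\<close> lead from \<open>\<lambda>\<^sub>M(x)\<close> to \<open>\<lambda>\<^sub>H(x)\<close> when \<open>u\<close> runs through
  the prefixes of \<open>x = u @ v\<close>, so they change at some symbol.\<close>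

lemma decomposition_from:
  assumes "s \<in> hyp_states c" and "x \<in> lists (inputs M)" and "lambda H s x \<noteq> lambda M (target M c s) x"
  shows "\<exists>u a v. x = u @ [a] @ v \<and>
    mq M (acc c (delta H s u) @ [a]) v \<noteq> mq M (acc c (delta H s (u @ [a]))) v"
  using assms
proof (induction x arbitrary: s)
  case (Cons a x)
  obtain q where q: "next_state H s a = q" "out_sym H s a = out_sym M (target M c s) a"
      "q \<in> hyp_states c"
    using closed_hypothesis[of s a] Cons.prems by auto
  show ?case
  proof (cases "mq M (acc c s @ [a]) x = mq M (acc c q) x")
    case True
    then have "lambda H q x \<noteq> lambda M (target M c q) x"
      using Cons.prems q by (simp add: mq_eq delta_append)
    then obtain u b v where "x = u @ [b] @ v"
        "mq M (acc c (delta H q u) @ [b]) v \<noteq> mq M (acc c (delta H q (u @ [b]))) v"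
      using Cons.IH[OF q(3)] Cons.prems by auto
    then show ?thesis using q(1) by (intro exI[of _ "a # u"]) auto
  next
    case False
    then show ?thesis using q(1) by (intro exI[of _ "[]"]) auto
  qed
qed simp

lemma decomposition:
  assumes "x \<in> lists (inputs M)" and "lambda0 H x \<noteq> lambda0 M x"
  obtains u a v where "x = u @ [a] @ v" and "v \<noteq> []"
    and "mq M (acc c (delta0 H u) @ [a]) v \<noteq> mq M (acc c (delta0 H (u @ [a]))) v"
proof -
  obtain u a v where "x = u @ [a] @ v"
      "mq M (acc c (delta0 H u) @ [a]) v \<noteq> mq M (acc c (delta0 H (u @ [a]))) v"
    using decomposition_from[OF zero_hyp assms(1)] assms(2) by (auto simp: init_H acc_zero)
  \<comment> \<open>On an empty suffix both queries return the empty word.\<close>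
  moreover from this have "v \<noteq> []" by (auto simp: mq_eq)
  ultimately show ?thesis using that by blast
qed

text \<open>The transition is closed, so the word sifts to the leaf of \<open>q\<close>. If it
  reached the target of some \<open>q'\<close>, then \<open>q'\<close> would be \<open>q\<close>,
  against the different outputs on \<open>v\<close>.\<close>

lemma new_target:
  assumes "s \<in> hyp_states c" and "a \<in> inputs M" and "next_state H s a = q"
    and "mq M (acc c s @ [a]) v \<noteq> mq M (acc c q) v"
  shows "delta0 M (acc c s @ [a]) \<notin> target M c ` hyp_states c"
proof
  assume "delta0 M (acc c s @ [a]) \<in> target M c ` hyp_states c"
  then obtain q' where q': "q' \<in> hyp_states c" "delta0 M (acc c s @ [a]) = target M c q'" by auto
  obtain p where p: "leaf (tree c) p q"
      "consistent M (delta0 M (acc c s @ [a])) (delta0 M (acc c s @ [a])) p"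
    using closed_hypothesis[OF assms(1,2)] assms(3) by metis
  obtain p' where "leaf (tree c) p' q'" using leaf_exists[OF q'(1)] by blast
  then have "q = q'" using leaf_unique(2) p q'(2) by metis
  then show False using assms(4) q'(2) by (simp add: mq_eq)
qed

text \<open>The word found by the decomposition reaches a state of \<open>M\<close> outside the
  image of \<open>hyp_states c\<close> under the injective map \<open>target M c\<close>.\<close>

lemma counterexample_card:
  assumes "finite (states M)" and "x \<in> lists (inputs M)" and "lambda0 H x \<noteq> lambda0 M x"
  shows "card (hyp_states c) < card (states M)"
proof -
  obtain u a v where x: "x = u @ [a] @ v"
      and neq: "mq M (acc c (delta0 H u) @ [a]) v \<noteq> mq M (acc c (delta0 H (u @ [a]))) v"
    using decomposition[OF assms(2,3)] by metis
  let ?s = "delta0 H u" and ?m = "delta0 M (acc c (delta0 H u) @ [a])"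
  have s: "?s \<in> hyp_states c" and a: "a \<in> inputs M"
    using delta_hyp zero_hyp assms(2) x by (auto simp: init_H)
  have new: "?m \<notin> target M c ` hyp_states c"
    using new_target[OF s a _ neq] by (simp add: delta_append)
  have "?m \<in> states M"
    using delta_in_states[OF mealy] acc_inputs[OF s] a mealy by (simp add: is_mealy_def)
  with new have "target M c ` hyp_states c \<subset> states M"
    using target_in_states by blast
  then show ?thesis
    using psubset_card_mono[OF assms(1)] card_image[OF inj_target] by metis
qed

end

section \<open>Preservation of soundness by the steps that change the hypothesis\<close>

lemma last_lambda: "last (lambda0 M (w @ [i])) = out_sym M (delta0 M w) i"
  by (simp add: lambda_append)

text \<open>The popped transition gets the leaf its word was sifted to, and sifting moves no
  referenced leaf, so the other transitions stay closed.\<close>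

lemma (in sound) close_known_sound:
  assumes "open_queue c = (s, i) # rest"
    and "w = acc c s @ [i]"
    and "sift M w (tree c) (delta0 M w) = (t, p)"
    and "leaf t p q"
  shows "sound M (c\<lparr>hyp_out := (hyp_out c)((s, i) \<mapsto> last (lambda0 M w)),
     hyp_next := (hyp_next c)((s, i) \<mapsto> q), tree := t, open_queue := rest\<rparr>)" (is "sound M ?c")
proof -
  note sift = sift_correct[OF assms(3)]
  have leaves: "leaf t p' q' \<longleftrightarrow> leaf (tree c) p' q'" for p' q' using sift by blast
  have cl: "closed M ?c s' i'" if "s' \<in> hyp_states c" "i' \<in> inputs M" "(s', i') \<notin> set rest" for s' i'
  proof (cases "(s', i') = (s, i)")
    case True
    then show ?thesis using sift assms(2,4)
      by (auto simp: closed_def last_lambda delta_append)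
  next
    case False
    then have "closed M c s' i'" using not_open_closed that assms(1) by auto
    then show ?thesis using False leaves by (auto simp: closed_def)
  qed
  have "s \<in> hyp_states c" "i \<in> inputs M" using open_hyp assms(1) by auto
  then show ?thesis
    using mealy finite_hyp zero_hyp acc_zero acc_inputs tree_inputs leaf_exists leaf_hyp
      leaf_consistent dom_next open_hyp cl leaves sift assms(1)
    by unfold_locales (simp_all, force+)
qed

text \<open>The new leaf replaces the unreferenced one at the end of the sifted path, so the access
  sequence of \<open>r\<close> sifts there by construction. All transitions of \<open>r\<close> are
  queued, so none of them has to be closed.\<close>

lemma (in sound) close_new_sound:
  assumes "open_queue c = (s, i) # rest"
    and "w = acc c s @ [i]"
    and "sift M w (tree c) (delta0 M w) = (t, p)"
    and "node_at t p (Final None)"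
    and "r \<notin> hyp_states c"
    and "enumerates js ({r} \<times> inputs M)"
  shows "sound M (c\<lparr>hyp_states := insert r (hyp_states c),
     hyp_out := (hyp_out c)((s, i) \<mapsto> last (lambda0 M w)),
     hyp_next := (hyp_next c)((s, i) \<mapsto> r), acc := (acc c)(r := w),
     tree := replace_at p (Final (Some r)) t, open_queue := rest @ js\<rparr>)" (is "sound M ?c")
proof -
  note sift = sift_correct[OF assms(3)]
  have leaves: "leaf (tree ?c) p' q' \<longleftrightarrow> leaf (tree c) p' q' \<or> p' = p \<and> q' = r" for p' q'
    using sift node_at_replace_at[OF assms(4) refl, of "Final (Some r)" p' "Some q'"]
      node_at_unique[OF assms(4)] by auto
  have js: "set js = {r} \<times> inputs M" using assms(6) by (simp add: enumerates_def)
  have si: "s \<in> hyp_states c" "i \<in> inputs M" using open_hyp assms(1) by auto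
  then have "s \<noteq> r" using assms(5) by auto
  have cl: "closed M ?c s' i'"
    if s': "s' \<in> hyp_states c" "i' \<in> inputs M" "(s', i') \<notin> set rest" for s' i'
  proof (cases "(s', i') = (s, i)")
    case True
    moreover have "leaf (tree ?c) p r" using leaves by blast
    ultimately show ?thesis using sift assms(2) \<open>s \<noteq> r\<close>
      by (auto simp: closed_def last_lambda delta_append)
  next
    case False
    then have "closed M c s' i'" using not_open_closed s' assms(1) by auto
    then obtain q' p' where qp: "hyp_next c (s', i') = Some q'"
        "hyp_out c (s', i') = Some (out_sym M (target M c s') i')" "leaf (tree c) p' q'"
        "consistent M (next_state M (target M c s') i') (next_state M (target M c s') i') p'"
      by (auto simp: closed_def)
    moreover have "leaf (tree ?c) p' q'" using leaves qp(3) by blast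
    moreover have "s' \<noteq> r" using s' assms(5) by auto
    ultimately show ?thesis using False by (auto simp: closed_def)
  qed
  show ?thesis
  proof (rule sound.intro)
    show "set_adt (tree ?c) \<subseteq> inputs M"
      using set_adt_replace_at[OF assms(4), of "Final (Some r)"] sift tree_inputs by auto
    show "acc ?c q' \<in> lists (inputs M)" if "q' \<in> hyp_states ?c" for q'
      using that acc_inputs assms(2) si by auto
    show "\<exists>p'. leaf (tree ?c) p' q'" if "q' \<in> hyp_states ?c" for q'
      by (cases "q' = r") (use that leaves leaf_exists[of q'] in auto)
    show "q' \<in> hyp_states ?c" if "leaf (tree ?c) p' q'" for p' q'
      using that leaves leaf_hyp by auto
    show "consistent M (target M ?c q') (target M ?c q') p'" if leaf: "leaf (tree ?c) p' q'" for p' q'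
    proof (cases "q' = r")
      case True
      then have "p' = p" using leaf leaves leaf_hyp assms(5) by blast
      then show ?thesis using True sift by simp
    next
      case False
      then show ?thesis using leaf leaves leaf_consistent by simp
    qed
    show "closed M ?c s' i'"
      if "s' \<in> hyp_states ?c" "i' \<in> inputs M" "(s', i') \<notin> set (open_queue ?c)" for s' i'
      using that js cl by auto
    show "dom (hyp_next ?c) \<subseteq> hyp_states ?c \<times> inputs M"
      using dom_next si by auto
    show "set (open_queue ?c) \<subseteq> hyp_states ?c \<times> inputs M"
      using open_hyp js assms(1) by auto
    show "acc ?c 0 = []"
      using acc_zero zero_hyp assms(5) by (cases "r = 0") auto
  qed (use mealy finite_hyp zero_hyp in simp_all)
qed

text \<open>Before the refinement the access words of \<open>q\<close> and \<open>r\<close> both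
  sift to \<open>p\<close>; the chain then sends them to different leaves. Only transitions into
  \<open>q\<close> lose their leaf, and these are reopened, while \<open>(s, a)\<close> is
  redirected to \<open>r\<close> and closed at once.\<close>

lemma (in sound_closed) refine_sound:
  assumes "u @ [a] @ v \<in> lists (inputs M)"
    and "s = delta0 H u"
    and "q = delta0 H (u @ [a])"
    and "mq M (acc c s @ [a]) v \<noteq> mq M (acc c q) v"
    and "r \<notin> hyp_states c"
    and "next' = (hyp_next c)((s, a) \<mapsto> r)"
    and "leaf (tree c) p q"
    and "sep = chain v (mq M (acc c q) v) (mq M (acc c s @ [a]) v) q r"
    and "enumerates js ({r} \<times> inputs M \<union> {e. next' e = Some q})"
  shows "sound M (c\<lparr>hyp_states := insert r (hyp_states c), hyp_next := next',
     acc := (acc c)(r := acc c s @ [a]),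
     tree := replace_at p (if p = [] then sep else Reset sep) (tree c), open_queue := js\<rparr>)"
    (is "sound M ?c")
proof -
  have s: "s \<in> hyp_states c" and a: "a \<in> inputs M" and v: "v \<in> lists (inputs M)"
    using delta_hyp[OF zero_hyp] assms(1,2) by (auto simp: init_H)
  have q_next: "q = next_state H s a" using assms(2,3) by (simp add: delta_append)
  define m where "m = delta0 M (acc c s @ [a])"
  obtain p0 where p0: "leaf (tree c) p0 q" "hyp_next c (s, a) = Some q"
      "hyp_out c (s, a) = Some (out_sym M (target M c s) a)" "consistent M m m p0"
    unfolding m_def by (rule closed_hypothesis[OF s a]) (use q_next in auto)
  \<comment> \<open>Hence the new access word follows the very path at which the tree is
    split.\<close>
  have "p0 = p"
    by (rule leaf_unique(1)[OF assms(7) p0(1) leaf_consistent[OF p0(1)]])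
  have sep: "sep = chain v (lambda M (target M c q) v) (lambda M m v) q r"
    and neq: "lambda M (target M c q) v \<noteq> lambda M m v"
    using assms(4,8) by (auto simp: mq_eq m_def)
  obtain pq pr where chain: "\<And>p' k. node_at sep p' (Final k) \<longleftrightarrow>
        (p' = pq \<and> k = Some q) \<or> (p' = pr \<and> k = Some r)"
      "consistent M (target M c q) (target M c q) pq" "consistent M m m pr"
    using chain_leaves[OF neq, of q r "target M c q" m] unfolding sep by blast
  \<comment> \<open>The path from the root to the chain; at the root no reset node is
    inserted.\<close>
  define link where "link = (if p = [] then [] else p @ [None])"
  \<comment> \<open>If the reset is omitted, \<open>p\<close> is empty and the chain is entered in
    \<open>m'\<close> anyway.\<close>
  have link: "consistent M m' m' (link @ p') \<longleftrightarrow> consistent M m' m' p \<and> consistent M m' m' p'" for m' p'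
    by (simp add: link_def consistent_append_reset)
  have sub: "(\<exists>p''. p' = p @ p'' \<and> node_at (if p = [] then sep else Reset sep) p'' (Final k)) \<longleftrightarrow>
      (\<exists>p''. p' = link @ p'' \<and> node_at sep p'' (Final k))" for p' k
    by (auto simp: link_def node_at_Reset)
  have unique: "p' = p \<longleftrightarrow> q' = q" if "leaf (tree c) p' q'" for p' q'
    using that assms(7) leaf_unique(1) leaf_consistent node_at_unique by (metis adt.inject(1) option.inject)
  have leaves: "leaf (tree ?c) p' q' \<longleftrightarrow>
      (leaf (tree c) p' q' \<and> q' \<noteq> q) \<or> (p' = link @ pq \<and> q' = q) \<or> (p' = link @ pr \<and> q' = r)" for p' q'
  proof -
    have "leaf (tree c) p' q' \<and> p' \<noteq> p \<longleftrightarrow> leaf (tree c) p' q' \<and> q' \<noteq> q"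
      using unique by blast
    moreover have "(\<exists>p''. p' = link @ p'' \<and> leaf sep p'' q') \<longleftrightarrow>
        (p' = link @ pq \<and> q' = q) \<or> (p' = link @ pr \<and> q' = r)"
      using chain(1) by auto
    ultimately show ?thesis
      using node_at_replace_at[OF assms(7) refl, of "if p = [] then sep else Reset sep" p' "Some q'"]
        sub[of p' "Some q'"] by simp
  qed
  have js: "set js = {r} \<times> inputs M \<union> {e. next' e = Some q}" using assms(9) by (simp add: enumerates_def)
  have q: "q \<in> hyp_states c" using leaf_hyp assms(7) by blast
  have neqs: "q \<noteq> r" "s \<noteq> r" using q s assms(5) by auto
  have cl: "closed M ?c s' i'"
    if s': "s' \<in> hyp_states c" "i' \<in> inputs M" "next' (s', i') \<noteq> Some q" for s' i'
  proof (cases "(s', i') = (s, a)")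
    case True
    have "leaf (tree ?c) (link @ pr) r" using leaves by blast
    moreover have "consistent M m m (link @ pr)" using link p0(4) \<open>p0 = p\<close> chain(3) by blast
    moreover have "m = next_state M (target M c s) a" by (simp add: m_def delta_append)
    ultimately show ?thesis using True assms(6) p0(3) neqs by (auto simp: closed_def)
  next
    case False
    obtain q' p' where qp: "hyp_next c (s', i') = Some q'"
        "hyp_out c (s', i') = Some (out_sym M (target M c s') i')" "leaf (tree c) p' q'"
        "consistent M (next_state M (target M c s') i') (next_state M (target M c s') i') p'"
      using not_open_closed[OF s'(1,2)] open_empty by (auto simp: closed_def)
    moreover have "q' \<noteq> q" using qp(1) s'(3) False assms(6) by auto
    then have "leaf (tree ?c) p' q'" using leaves qp(3) by blast
    moreover have "s' \<noteq> r" using s' assms(5) by auto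
    ultimately show ?thesis using False assms(6) by (auto simp: closed_def)
  qed
  show ?thesis
  proof (rule sound.intro)
    have "set_adt sep \<subseteq> inputs M"
      using set_adt_chain[of "lambda M (target M c q) v" v "lambda M m v"] neq v sep by auto
    then show "set_adt (tree ?c) \<subseteq> inputs M"
      using set_adt_replace_at[OF assms(7), of "if p = [] then sep else Reset sep"] tree_inputs
      by (auto split: if_splits)
    show "acc ?c q' \<in> lists (inputs M)" if "q' \<in> hyp_states ?c" for q'
      using that acc_inputs s a by auto
    show "\<exists>p'. leaf (tree ?c) p' q'" if "q' \<in> hyp_states ?c" for q'
      by (cases "q' = r"; cases "q' = q") (use that leaves leaf_exists[of q'] in auto)
    show "q' \<in> hyp_states ?c" if "leaf (tree ?c) p' q'" for p' q'
      using that q leaf_hyp unfolding leaves by auto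
    show "consistent M (target M ?c q') (target M ?c q') p'" if leaf: "leaf (tree ?c) p' q'" for p' q'
    proof -
      consider "leaf (tree c) p' q'" "q' \<noteq> r" | "p' = link @ pq" "q' = q" | "p' = link @ pr" "q' = r"
        using leaf leaf_hyp assms(5) unfolding leaves by blast
      then show ?thesis
      proof cases
        case 1
        then show ?thesis using leaf_consistent by simp
      next
        case 2
        then show ?thesis using link leaf_consistent[OF assms(7)] chain(2) neqs by simp
      next
        case 3
        then show ?thesis using link p0(4) \<open>p0 = p\<close> chain(3) by (simp add: m_def)
      qed
    qed
    show "closed M ?c s' i'"
      if "s' \<in> hyp_states ?c" "i' \<in> inputs M" "(s', i') \<notin> set (open_queue ?c)" for s' i'
      using that js cl by auto
    have dom': "dom next' \<subseteq> hyp_states c \<times> inputs M"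
      using dom_next s a assms(6) by auto
    then show "dom (hyp_next ?c) \<subseteq> hyp_states ?c \<times> inputs M" by auto
    show "set (open_queue ?c) \<subseteq> hyp_states ?c \<times> inputs M"
      using dom' js by auto
    show "acc ?c 0 = []"
      using acc_zero zero_hyp assms(5) by (cases "r = 0") auto
  qed (use mealy finite_hyp zero_hyp in simp_all)
qed

section \<open>Counting counterexamples and the termination measure\<close>

text \<open>Includes the counterexample being processed, which has left the queue but is dropped
  only once the hypothesis agrees with it.\<close>

definition pending :: "('i, 'o) config \<Rightarrow> ('i list \<times> 'o list) set" where
  "pending c = set (ce_queue c) \<union> (case phase c of Internal x y \<Rightarrow> {(x, y)} | _ \<Rightarrow> {})"

definition genuine :: "('s, 'i, 'o) mealy \<Rightarrow> ('i, 'o) config \<Rightarrow> bool" where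
  "genuine M c \<longleftrightarrow> (\<exists>(x, y) \<in> pending c. lambda0 (hypothesis M c) x \<noteq> y)"

text \<open>The third conjunct carries the counting argument: until a state has been added since the last
  equivalence query, a genuine counterexample remains pending.\<close>

definition invariant :: "('s, 'i, 'o) mealy \<Rightarrow> ('i, 'o) config \<Rightarrow> bool" where
  "invariant M c \<longleftrightarrow> sound M c \<and>
     (\<forall>(x, y) \<in> pending c. x \<in> lists (inputs M) \<and> y = lambda0 M x) \<and>
     (ce_queries c < card (hyp_states c) \<or> open_queue c = [] \<and> genuine M c) \<and>
     (open_queue c \<noteq> [] \<longrightarrow> phase c = Query \<or> (\<exists>x y. phase c = Internal x y)) \<and>
     (phase c = Outer \<longrightarrow> ce_queue c = [] \<or> genuine M c) \<and>
     (phase c = Query \<or> phase c = Returned \<longrightarrow> ce_queue c = []) \<and>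
     ce_queries c \<le> card (hyp_states c) \<and> ce_queries c < card (states M)"

text \<open>Balanced against a queue entry, which weighs 2: popping one costs 1 for
  \<open>Internal\<close>. \<open>Outer\<close> exceeds both its successors, \<open>Inner\<close>
  and \<open>Query\<close>.\<close>

fun stage :: "('i, 'o) phase \<Rightarrow> nat" where
  "stage Returned = 0"
| "stage Query = 1"
| "stage Outer = 2"
| "stage Inner = 0"
| "stage (Internal x y) = 1"

fun refining :: "('i, 'o) phase \<Rightarrow> bool" where
  "refining Inner = True"
| "refining (Internal x y) = True"
| "refining ph = False"

text \<open>The fourth component serves the check of traces: there nothing genuine is pending, so 2
  drops to 1 if a trace is violated and to 0 otherwise. Entering \<open>Inner\<close> does not raise
  it, because a non-empty queue in \<open>Outer\<close> contains a genuine counterexample.\<close>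

definition progress :: "('s, 'i, 'o) mealy \<Rightarrow> (('i, 'o) config \<times> ('i, 'o) config) set" where
  "progress M = measures
     [\<lambda>c. card (states M) - card (hyp_states c),
      \<lambda>c. card (states M) - ce_queries c,
      \<lambda>c. length (open_queue c),
      \<lambda>c. if genuine M c then 1 else if refining (phase c) then 2 else 0,
      \<lambda>c. 2 * length (ce_queue c) + stage (phase c)]"

lemma hypothesis_update [simp]:
  "hypothesis M (c\<lparr>phase := ph\<rparr>) = hypothesis M c"
  "hypothesis M (c\<lparr>ce_queue := cq\<rparr>) = hypothesis M c"
  "hypothesis M (c\<lparr>ce_queries := k\<rparr>) = hypothesis M c"
  by (simp_all add: hypothesis_def)

lemma sound_update [simp]:
  "sound M (c\<lparr>phase := ph\<rparr>) = sound M c"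
  "sound M (c\<lparr>ce_queue := cq\<rparr>) = sound M c"
  "sound M (c\<lparr>ce_queries := k\<rparr>) = sound M c"
  by (simp_all add: sound_def closed_def)

lemma initial_invariant:
  assumes "is_mealy M" and "finite (states M)" and "initial M c"
  shows "invariant M c"
proof -
  have "0 < card (states M)"
    using assms(1,2) by (auto simp: is_mealy_def card_gt_0_iff)
  moreover obtain js where js: "set js = {0} \<times> inputs M"
    and c: "c = \<lparr>hyp_states = {0}, hyp_next = Map.empty, hyp_out = Map.empty, acc = (\<lambda>_. []),
            tree = Final (Some 0), open_queue = js, ce_queue = [], phase = Query,
            ce_queries = 0\<rparr>"
    using assms(3) unfolding initial_def enumerates_def by blast
  have "sound M c"
    by unfold_locales (use assms(1) js in \<open>simp_all add: c\<close>)
  ultimately show ?thesis by (simp add: invariant_def pending_def c)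
qed

text \<open>A new state makes the count strict, whatever the changed hypothesis does to the pending
  counterexamples. The phase is not \<open>Outer\<close>, where a genuine one may be
  demanded.\<close>

lemma new_state_invariant:
  assumes "finite (states M)" and inv: "invariant M c" and "sound M c'"
    and card: "card (hyp_states c') = Suc (card (hyp_states c))"
    and same: "ce_queue c' = ce_queue c" "phase c' = phase c" "ce_queries c' = ce_queries c"
    and phase: "phase c = Query \<or> (\<exists>x y. phase c = Internal x y)"
  shows "invariant M c' \<and> (c', c) \<in> progress M"
proof
  have "pending c' = pending c" using same by (simp add: pending_def)
  moreover have "phase c \<noteq> Outer" using phase by auto
  ultimately show "invariant M c'"
    using inv assms(3) same phase unfolding invariant_def card by simp
  have "card (hyp_states c') \<le> card (states M)"
    using sound.card_hyp assms(1,3) by blast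
  then have "card (states M) - card (hyp_states c') < card (states M) - card (hyp_states c)"
    using card by linarith
  then show "(c', c) \<in> progress M" by (simp add: progress_def)
qed

lemma step_invariant:
  assumes fin: "finite (states M)" and inv: "invariant M c" and step: "step M c c'"
  shows "invariant M c' \<and> (c', c) \<in> progress M"
proof -
  interpret sound M c using inv by (simp add: invariant_def)
  show ?thesis
    using step
  proof cases
    case (close_known s i rest w t p q)
    have "sound M c'"
      using close_known_sound[OF close_known(2-5)] close_known(1) by simp
    \<comment> \<open>While a transition is open the count is already strict and the phase is not
      \<open>Outer\<close>, so no genuine counterexample has to survive the change of the
      hypothesis.\<close>
    then show ?thesis
      using inv close_known(1,2) by (auto simp: invariant_def pending_def progress_def)
  next
    case (close_new s i rest w t p r js)
    have s: "sound M c'"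
      using close_new_sound[OF close_new(2-7)] close_new(1) by simp
    have "card (hyp_states c') = Suc (card (hyp_states c))"
      using close_new(1,6) finite_hyp by simp
    moreover have "phase c = Query \<or> (\<exists>x y. phase c = Internal x y)"
      using inv close_new(2) by (simp add: invariant_def)
    ultimately show ?thesis
      using new_state_invariant[OF fin inv s] close_new(1) by simp
  next
    case confirm
    then show ?thesis
      using inv by (auto simp: invariant_def pending_def progress_def genuine_def)
  next
    case (counterexample w)
    interpret sound_closed M c by unfold_locales (fact counterexample(2))
    have "card (hyp_states c) < card (states M)"
      using counterexample_card[OF fin counterexample(4,5)] .
    \<comment> \<open>With an empty queue nothing is pending, so the count is strict; since
      \<open>card (hyp_states c)\<close> is itself below \<open>card (states M)\<close>, one more
      query respects the bound.\<close>
    moreover have "ce_queries c < card (hyp_states c)" "ce_queue c = []"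
      using inv counterexample(1-3) by (auto simp: invariant_def pending_def genuine_def)
    ultimately show ?thesis
      using inv counterexample by (auto simp: invariant_def pending_def progress_def genuine_def)
  next
    case outer_enter
    then show ?thesis
      using inv by (auto simp: invariant_def pending_def progress_def genuine_def)
  next
    case outer_exit
    then show ?thesis
      using inv by (auto simp: invariant_def pending_def progress_def genuine_def)
  next
    case (inner_pop x y rest)
    then show ?thesis
      using inv by (auto simp: invariant_def pending_def progress_def genuine_def)
  next
    case (internal_refine x y u a v s q r next' p sep js)
    interpret sound_closed M c by unfold_locales (fact internal_refine(2))
    have "x \<in> lists (inputs M)"
      using inv internal_refine(3) by (auto simp: invariant_def pending_def)
    then have s: "sound M c'"
      using refine_sound[of u a v s q r next' p sep js] internal_refine by simp
    have "card (hyp_states c') = Suc (card (hyp_states c))"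
      using internal_refine(1,10) finite_hyp by simp
    then show ?thesis
      using new_state_invariant[OF fin inv s] internal_refine(1,3) by simp
  next
    case (internal_done x y)
    then show ?thesis
      using inv by (auto simp: invariant_def pending_def progress_def genuine_def)
  next
    case (check_traces vs)
    let ?cex = "\<lambda>(p, q, x, y). (acc c q @ x, lambda0 M (acc c q) @ y)"
    have vs: "set vs = violated M c" using check_traces by (simp add: enumerates_def)
    have not_genuine: "\<not> genuine M c" using check_traces by (simp add: genuine_def pending_def)
    have queue: "ce_queue c' = map ?cex vs" and H: "hypothesis M c' = H"
      and phase: "phase c' = Outer"
      using check_traces(1) by simp_all
    have pending: "pending c' = ?cex ` violated M c"
      using phase queue vs by (simp add: pending_def)
    have cex: "x \<in> lists (inputs M) \<and> y = lambda0 M x \<and> lambda0 H x \<noteq> y"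
      if cx: "(x, y) \<in> pending c'" for x y
    proof -
      obtain p q x' y' where v: "(p, q, x', y') \<in> violated M c"
          and "x = acc c q @ x'" "y = lambda0 M (acc c q) @ y'"
        using cx unfolding pending by auto
      with violated_counterexample[OF v] show ?thesis by metis
    qed
    then have "\<forall>(x, y) \<in> pending c'. x \<in> lists (inputs M) \<and> y = lambda0 M x" by blast
    \<comment> \<open>Every queued trace contradicts the hypothesis, which this step leaves
      unchanged.\<close>
    moreover have "vs = [] \<or> genuine M c'"
    proof (cases "pending c' = {}")
      case True
      then show ?thesis unfolding pending vs[symmetric] by simp
    next
      case False
      then obtain x y where "(x, y) \<in> pending c'" by (metis ex_in_conv surj_pair)
      with cex[OF this] have "genuine M c'" unfolding genuine_def H by (intro bexI[of _ "(x, y)"]) auto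
      then show ?thesis ..
    qed
    ultimately show ?thesis
      using inv check_traces(1-4) not_genuine queue phase
      by (auto simp: invariant_def progress_def)
  qed
qed

section \<open>Absence of deadlock\<close>

lemma enumerates_exists: "finite A \<Longrightarrow> \<exists>js. enumerates js A"
  using finite_distinct_list[of A] by (auto simp: enumerates_def)

text \<open>Every other control point has an enabled step: a fresh state and orderings of the queued
  items exist by finiteness, a counterexample that still refutes the hypothesis can be decomposed,
  and every hypothesis state has a leaf to split.\<close>

lemma stuck_returned:
  assumes inv: "invariant M c" and stuck: "\<nexists>c'. step M c c'"
  shows "phase c = Returned"
proof -
  interpret sound M c using inv by (simp add: invariant_def)
  have fin_inputs: "finite (inputs M)" using mealy by (simp add: is_mealy_def)
  obtain r where r: "r \<notin> hyp_states c" using ex_new_if_finite finite_hyp by blast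
  have open_empty: "open_queue c = []"
  proof (rule ccontr)
    assume "open_queue c \<noteq> []"
    then obtain s i rest where open_queue: "open_queue c = (s, i) # rest"
      by (metis list.exhaust surj_pair)
    obtain t p where sift: "sift M (acc c s @ [i]) (tree c) (delta0 M (acc c s @ [i])) = (t, p)"
      by fastforce
    obtain f where f: "node_at t p (Final f)" by (rule exE[OF conjunct1[OF conjunct2[OF sift_correct[OF sift]]]])
    obtain js where js: "enumerates js ({r} \<times> inputs M)"
      using enumerates_exists[of "{r} \<times> inputs M"] fin_inputs by auto
    show False
    proof (cases f)
      case None
      then show ?thesis using step.close_new[OF open_queue refl sift _ r js] f stuck by blast
    next
      case (Some q)
      then show ?thesis using step.close_known[OF open_queue refl sift] f stuck by blast
    qed
  qed
  then interpret sound_closed M c by unfold_locales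
  show ?thesis
  proof (cases "phase c")
    case Query
    then show ?thesis
      using step.confirm[OF open_empty Query] step.counterexample[OF open_empty Query] stuck
      unfolding equivalent_def by metis
  next
    case Outer
    then show ?thesis using step.outer_enter[OF open_empty Outer] step.outer_exit[OF open_empty Outer] stuck by blast
  next
    case Inner
    obtain vs where "enumerates vs (violated M c)"
      using enumerates_exists[OF finite_violated] by auto
    then show ?thesis
      using step.inner_pop[OF open_empty Inner] step.check_traces[OF open_empty Inner] stuck
      by (cases "ce_queue c") (blast, metis surj_pair)
  next
    case (Internal x y)
    show ?thesis
    proof (cases "lambda0 H x = y")
      case True
      then show ?thesis using step.internal_done[OF open_empty Internal] stuck by blast
    next
      case False
      have x: "x \<in> lists (inputs M)" "y = lambda0 M x"
        using inv Internal by (auto simp: invariant_def pending_def)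
      obtain u a v where d: "x = u @ [a] @ v" "v \<noteq> []"
          "mq M (acc c (delta0 H u) @ [a]) v \<noteq> mq M (acc c (delta0 H (u @ [a]))) v"
        using decomposition[OF x(1)] False x(2) by blast
      let ?s = "delta0 H u" and ?q = "delta0 H (u @ [a])"
      let ?next = "(hyp_next c)((?s, a) \<mapsto> r)"
      have "?s \<in> hyp_states c" "?q \<in> hyp_states c"
        using delta_hyp[OF zero_hyp] x(1) d(1) by (auto simp: init_H)
      then obtain p where p: "leaf (tree c) p ?q" using leaf_exists by blast
      have "finite (hyp_states c \<times> inputs M)" using finite_hyp fin_inputs by blast
      then have "finite (dom ?next)" using dom_next by (simp add: finite_subset)
      then have "finite {e. ?next e = Some ?q}"
        by (rule rev_finite_subset) auto
      then obtain js where js: "enumerates js ({r} \<times> inputs M \<union> {e. ?next e = Some ?q})"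
        using enumerates_exists[of "{r} \<times> inputs M \<union> {e. ?next e = Some ?q}"] fin_inputs by auto
      show ?thesis
        using step.internal_refine[OF open_empty Internal False d(1,2) refl refl d(3) r refl p refl js]
          stuck by blast
    qed
  qed
qed

lemma reachable_invariant:
  assumes "is_mealy M" and "finite (states M)" and "reachable M c"
  shows "invariant M c"
proof -
  obtain c0 where "initial M c0" and steps: "(step M)\<^sup>*\<^sup>* c0 c"
    using assms(3) by (auto simp: reachable_def)
  then have "invariant M c0" using initial_invariant assms(1,2) by blast
  with steps show ?thesis
  proof (induction rule: rtranclp_induct)
    case (step c c')
    then show ?case using step_invariant[OF assms(2), of c c'] by simp
  qed
qed

theorem theorem2:
  fixes M :: "('s, 'i, 'o) mealy" and n :: nat
  assumes "is_mealy M" and "finite (states M)" and "minimal M"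
    and "n = card (states M)"
  shows "terminates M \<and> (\<forall>c. reachable M c \<longrightarrow> ce_queries c \<le> n - 1)"
proof (intro conjI allI impI)
  have False if init: "initial M (run 0)" and steps: "\<And>k. step M (run k) (run (Suc k))"
    for run :: "nat \<Rightarrow> ('i, 'o) config"
  proof -
    have inv: "invariant M (run k)" for k
    proof (induction k)
      case 0
      then show ?case using initial_invariant[OF assms(1,2) init] .
    next
      case (Suc k)
      then show ?case using step_invariant[OF assms(2) Suc steps] by blast
    qed
    have "(run (Suc k), run k) \<in> progress M" for k
      using step_invariant[OF assms(2) inv steps] by blast
    moreover have "wf (progress M)" by (simp add: progress_def)
    ultimately show False unfolding wf_iff_no_infinite_down_chain by blast
  qed
  moreover have "phase c = Returned" if "reachable M c" and "\<nexists>c'. step M c c'" for c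
    using stuck_returned[OF reachable_invariant[OF assms(1,2) that(1)] that(2)] .
  ultimately show "terminates M" unfolding terminates_def by (intro conjI notI allI impI) (blast, meson)
next
  fix c assume "reachable M c"
  then have "ce_queries c < card (states M)"
    using reachable_invariant[OF assms(1,2)] by (simp add: invariant_def)
  \<comment> \<open>The strict bound forces \<open>n > 0\<close>, so the truncated subtraction is
    exact.\<close>
  then show "ce_queries c \<le> n - 1" using assms(4) by simp
qed

end
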